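(* Let $p(\mathbf{x};t)$ be the Gaussian probability density on $\mathbb{R}^n$ with mean $\boldsymbol{\mu}(t)$ and positive definite covariance $\boldsymbol{\Sigma}(t)$, governed by $$\dot{\boldsymbol{\mu}}=\mathbf{A}\boldsymbol{\mu}+\mathbf{B}\mathbf{u}(t),\qquad \dot{\boldsymbol{\Sigma}}=\mathbf{A}\boldsymbol{\Sigma}+\boldsymbol{\Sigma}\mathbf{A}^\top+2\mathbf{D},$$ where $\mathbf{A}\in\mathbb{R}^{n\times n}$, $\mathbf{B}\in\mathbb{R}^{n\times p}$ are constant, $\mathbf{u}(t)\in\mathbb{R}^p$ is continuous, and $\mathbf{D}=\mathbf{D}(t)$ is diagonal with $D_{ii}>0$ for all $i$. Then at every time $t$ the entropy production $\Pi$ and the entropy flow $\Phi$ are given by $$\Pi=\dot{\boldsymbol{\mu}}^\top\mathbf{D}^{-1}\dot{\boldsymbol{\mu}}+\operatorname{Tr}\left(\mathbf{A}^\top\mathbf{D}^{-1}\mathbf{A}\boldsymbol{\Sigma}\right)+\operatorname{Tr}\left(\boldsymbol{\Sigma}^{-1}\mathbf{D}\right)+2\operatorname{Tr}(\mathbf{A}),$$ $$\Phi=\dot{\boldsymbol{\mu}}^\top\mathbf{D}^{-1}\dot{\boldsymbol{\mu}}+\operatorname{Tr}\left(\mathbf{A}^\top\mathbf{D}^{-1}\mathbf{A}\boldsymbol{\Sigma}\right)+\operatorname{Tr}(\mathbf{A}).$$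
   Context: The process is the linear Langevin system $\dot x_i=f_i(\mathbf{x};t)+\xi_i(t)$, $i=1,\dots,n$, with $f_i(\mathbf{x};t)=\sum_{j=1}^n a_{ij}x_j+\sum_{j} b_{ij}u_j(t)$, where $\mathbf{A}=(a_{ij})$, $\mathbf{B}=(b_{ij})$, and noise satisfying $\langle\xi_i(t)\rangle=0$, $\langle\xi_i(t)\xi_j(t')\rangle=2D_{ij}\delta(t-t')$. Its density solves the Fokker-Planck equation $\partial_t p=-\sum_i\partial_{x_i}J_i$ with probability current $$J_i(\mathbf{x};t)=f_i(\mathbf{x};t)p(\mathbf{x};t)-\sum_j D_{ij}\,\partial_{x_j}p(\mathbf{x};t).$$ For Gaussian initial data the density is $p(\mathbf{x};t)=\det(2\pi\boldsymbol{\Sigma}(t))^{-1/2}\exp\left(-\tfrac12(\mathbf{x}-\boldsymbol{\mu}(t))^\top\boldsymbol{\Sigma}(t)^{-1}(\mathbf{x}-\boldsymbol{\mu}(t))\right)$ with $\boldsymbol\mu,\boldsymbol\Sigma$ solving the equations in the claim. For $\mathbf{D}$ diagonal with positive diagonal entries, define $$\Pi=\sum_i\int_{\mathbb{R}^n}\frac{J_i(\mathbf{x};t)^2}{D_{ii}\,p(\mathbf{x};t)}\,d^nx\quad\text{(entropy production)},\qquad \Phi=\sum_i\int_{\mathbb{R}^n}\frac{J_i(\mathbf{x};t)f_i(\mathbf{x};t)}{D_{ii}}\,d^nx\quad\text{(entropy flow)}.$$ *)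

theory Defs
  imports "HOL-Analysis.Analysis"
begin

definition pos_def_matrix :: "real ^ 'n ^ 'n \<Rightarrow> bool" where
  "pos_def_matrix S \<longleftrightarrow> transpose S = S \<and> (\<forall>x. x \<noteq> 0 \<longrightarrow> x \<bullet> (S *v x) > 0)"

definition diagonal_matrix :: "real ^ 'n ^ 'n \<Rightarrow> bool" where
  "diagonal_matrix M \<longleftrightarrow> (\<forall>i j. i \<noteq> j \<longrightarrow> M $ i $ j = 0)"

definition gaussian_density :: "real ^ 'n \<Rightarrow> real ^ 'n ^ 'n \<Rightarrow> real ^ 'n \<Rightarrow> real" where
  "gaussian_density m S x =
     det ((2 * pi) *\<^sub>R S) powr (- 1 / 2) * exp (- (1 / 2) * ((x - m) \<bullet> (matrix_inv S *v (x - m))))"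

definition partial_deriv :: "'n \<Rightarrow> (real ^ 'n \<Rightarrow> real) \<Rightarrow> real ^ 'n \<Rightarrow> real" where
  "partial_deriv j g x = deriv (\<lambda>s. g (x + s *\<^sub>R axis j 1)) 0"

text \<open>
  The following quantities are instantaneous: \<open>u\<close>, \<open>D\<close> and the density \<open>p\<close> are
  the input vector, diffusion matrix and density at one fixed time.
\<close>

definition drift :: "real ^ 'n ^ 'n \<Rightarrow> real ^ 'm ^ 'n \<Rightarrow> real ^ 'm \<Rightarrow> real ^ 'n \<Rightarrow> real ^ 'n" where
  "drift A B u x = (\<chi> i. (\<Sum>j\<in>UNIV. A $ i $ j * x $ j) + (\<Sum>j\<in>UNIV. B $ i $ j * u $ j))"

definition prob_current ::
  "real ^ 'n ^ 'n \<Rightarrow> real ^ 'm ^ 'n \<Rightarrow> real ^ 'n ^ 'n \<Rightarrow> real ^ 'm \<Rightarrow> (real ^ 'n \<Rightarrow> real)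
     \<Rightarrow> real ^ 'n \<Rightarrow> real ^ 'n" where
  "prob_current A B D u p x =
     (\<chi> i. drift A B u x $ i * p x - (\<Sum>j\<in>UNIV. D $ i $ j * partial_deriv j p x))"

definition production_integrand ::
  "real ^ 'n ^ 'n \<Rightarrow> real ^ 'm ^ 'n \<Rightarrow> real ^ 'n ^ 'n \<Rightarrow> real ^ 'm \<Rightarrow> (real ^ 'n \<Rightarrow> real)
     \<Rightarrow> 'n \<Rightarrow> real ^ 'n \<Rightarrow> real" where
  "production_integrand A B D u p i x = (prob_current A B D u p x $ i)\<^sup>2 / (D $ i $ i * p x)"

definition flow_integrand ::
  "real ^ 'n ^ 'n \<Rightarrow> real ^ 'm ^ 'n \<Rightarrow> real ^ 'n ^ 'n \<Rightarrow> real ^ 'm \<Rightarrow> (real ^ 'n \<Rightarrow> real)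
     \<Rightarrow> 'n \<Rightarrow> real ^ 'n \<Rightarrow> real" where
  "flow_integrand A B D u p i x = prob_current A B D u p x $ i * drift A B u x $ i / D $ i $ i"

definition entropy_production ::
  "real ^ 'n ^ 'n \<Rightarrow> real ^ 'm ^ 'n \<Rightarrow> real ^ 'n ^ 'n \<Rightarrow> real ^ 'm \<Rightarrow> (real ^ 'n \<Rightarrow> real) \<Rightarrow> real" where
  "entropy_production A B D u p =
     (\<Sum>i\<in>UNIV. LINT x|lborel. production_integrand A B D u p i x)"

definition entropy_flow ::
  "real ^ 'n ^ 'n \<Rightarrow> real ^ 'm ^ 'n \<Rightarrow> real ^ 'n ^ 'n \<Rightarrow> real ^ 'm \<Rightarrow> (real ^ 'n \<Rightarrow> real) \<Rightarrow> real" where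
  "entropy_flow A B D u p =
     (\<Sum>i\<in>UNIV. LINT x|lborel. flow_integrand A B D u p i x)"

end

theory Submission
  imports Defs "HOL-Probability.Distributions"
begin

text \<open>
  Since \<open>\<partial>\<^sub>j p = - (\<Sigma>\<^sup>-\<^sup>1 (x - \<mu>))\<^sub>j p\<close>, the current is \<open>J\<^sub>i = p \<cdot> (\<mu>'\<^sub>i + w\<^sub>i \<bullet> (x - \<mu>))\<close>, where \<open>w\<^sub>i\<close> is the
  \<open>i\<close>-th row of \<open>A + D \<Sigma>\<^sup>-\<^sup>1\<close>. Both integrands are therefore the density times a product of two affine
  functions, and \<open>\<integral> p (a + v \<bullet> (x - \<mu>)) (b + w \<bullet> (x - \<mu>)) = a b + v \<bullet> \<Sigma> w\<close>. The latter reduces to the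
  standard Gaussian by the substitution \<open>x = \<mu> + N z\<close> with \<open>N N\<^sup>T = \<Sigma>\<close>.
\<close>

section \<open>Linear change of variables\<close>


lemma Basis_eq_range_axis: "(Basis :: (real^'n) set) = range (\<lambda>i. axis i 1)"
  by (auto simp: Basis_vec_def)

lemma inj_axis: "inj (\<lambda>i. axis i 1 :: real^'n)"
  by (auto simp: inj_on_def axis_eq_axis)

lemma prod_Basis_cart: "(\<Prod>b\<in>Basis. g b) = (\<Prod>i\<in>UNIV. g (axis i 1 :: real^'n))"
  unfolding Basis_eq_range_axis by (subst prod.reindex[OF inj_axis]) simp

lemma borel_measurable_matrix_vector_mult [measurable]:
  "(*v) (A :: real^'n^'m) \<in> borel_measurable borel"
  by (intro borel_measurable_continuous_onI linear_continuous_on linear_conv_bounded_linear[THEN iffD1]) simp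

text \<open>By Fubini the coordinate along \<open>e\<close> can be integrated first. With the others
  fixed, the shear only translates it by a constant, and one-dimensional Lebesgue measure is
  translation invariant.\<close>

lemma nn_integral_lborel_shear:
  fixes e e' :: "'a::euclidean_space"
  assumes e: "e \<in> Basis" "e' \<in> Basis" "e \<noteq> e'" and h [measurable]: "h \<in> borel_measurable borel"
  shows "(\<integral>\<^sup>+x. h (x + (x \<bullet> e') *\<^sub>R e) \<partial>lborel) = (\<integral>\<^sup>+x. h x \<partial>lborel)"
proof -
  interpret product_sigma_finite "\<lambda>_::'a. lborel :: real measure" ..
  define J where "J = Basis - {e}"
  have J: "finite J" "e \<notin> J" "Basis = insert e J" "e' \<in> J"
    using e by (auto simp: J_def)
  define rest where "rest y = (\<Sum>b\<in>J. y b *\<^sub>R b)" for y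
  have split: "(\<integral>\<^sup>+x. k x \<partial>lborel)
      = (\<integral>\<^sup>+y. (\<integral>\<^sup>+s. k (s *\<^sub>R e + rest y) \<partial>lborel) \<partial>Pi\<^sub>M J (\<lambda>_. lborel))"
    if k [measurable]: "k \<in> borel_measurable borel" for k :: "'a \<Rightarrow> ennreal"
  proof -
    have m: "(\<lambda>f. \<Sum>b\<in>Basis. f b *\<^sub>R b) \<in> borel_measurable (Pi\<^sub>M (insert e J) (\<lambda>_. lborel :: real measure))"
      unfolding J(3)[symmetric] by measurable
    have *: "(\<Sum>b\<in>Basis. (y(e := s)) b *\<^sub>R b) = s *\<^sub>R e + rest y" for y :: "'a \<Rightarrow> real" and s
    proof -
      have "(\<Sum>b\<in>J. (y(e := s)) b *\<^sub>R b) = rest y"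
        unfolding rest_def using J(2) by (intro sum.cong) auto
      then show ?thesis
        unfolding J(3) by (subst sum.insert) (use J in auto)
    qed
    have "(\<integral>\<^sup>+x. k x \<partial>lborel) = (\<integral>\<^sup>+f. k (\<Sum>b\<in>Basis. f b *\<^sub>R b) \<partial>Pi\<^sub>M Basis (\<lambda>_. lborel))"
      by (subst lborel_eq) (auto intro!: nn_integral_distr)
    also have "\<dots> = (\<integral>\<^sup>+f. k (\<Sum>b\<in>Basis. f b *\<^sub>R b) \<partial>Pi\<^sub>M (insert e J) (\<lambda>_. lborel))"
      using J(3) by simp
    also have "\<dots> = (\<integral>\<^sup>+y. (\<integral>\<^sup>+s. k (\<Sum>b\<in>Basis. (y(e := s)) b *\<^sub>R b) \<partial>lborel) \<partial>Pi\<^sub>M J (\<lambda>_. lborel))"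
      by (rule product_nn_integral_insert) (use J m in \<open>auto intro: measurable_compose[OF m k]\<close>)
    finally show ?thesis
      unfolding * .
  qed
  \<comment> \<open>Since \<open>e'\<close> differs from \<open>e\<close>, the amount of the shift
    does not depend on the inner variable \<open>s\<close>.\<close>
  have e': "(s *\<^sub>R e + rest y) \<bullet> e' = y e'" for s y
  proof -
    have "rest y \<bullet> e' = (\<Sum>b\<in>J. if b = e' then y b else 0)"
      unfolding rest_def inner_sum_left
      by (intro sum.cong) (use e in \<open>auto simp: J_def inner_Basis\<close>)
    then show ?thesis
      using e J by (simp add: inner_add_left inner_Basis)
  qed
  \<comment> \<open>The factor \<open>1 * s\<close> keeps the form \<open>t + c * s\<close> of
    \<open>nn_integral_real_affine\<close>, here with slope 1.\<close>
  have shift: "(\<integral>\<^sup>+s. h ((t + 1 * s) *\<^sub>R e + r) \<partial>lborel) = (\<integral>\<^sup>+s. h (s *\<^sub>R e + r) \<partial>lborel)" for t r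
    using nn_integral_real_affine[of "\<lambda>s. h (s *\<^sub>R e + r)" 1 t] by simp
  have "(\<integral>\<^sup>+x. h (x + (x \<bullet> e') *\<^sub>R e) \<partial>lborel)
      = (\<integral>\<^sup>+y. (\<integral>\<^sup>+s. h ((y e' + 1 * s) *\<^sub>R e + rest y) \<partial>lborel) \<partial>Pi\<^sub>M J (\<lambda>_. lborel))"
  proof -
    have eq: "s *\<^sub>R e + rest y + y e' *\<^sub>R e = (y e' + 1 * s) *\<^sub>R e + rest y" for s y
      by (simp add: algebra_simps)
    show ?thesis
      by (subst split) (simp, simp only: e' eq)
  qed
  also have "\<dots> = (\<integral>\<^sup>+y. (\<integral>\<^sup>+s. h (s *\<^sub>R e + rest y) \<partial>lborel) \<partial>Pi\<^sub>M J (\<lambda>_. lborel))"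
    unfolding shift ..
  also have "\<dots> = (\<integral>\<^sup>+x. h x \<partial>lborel)"
    by (rule split[symmetric]) simp
  finally show ?thesis .
qed

text \<open>Lebesgue measure is determined by its values on boxes, and permuting coordinates turns a
  box into one with the same side lengths in another order.\<close>

lemma lborel_distr_permute:
  fixes \<pi> :: "'n::finite \<Rightarrow> 'n"
  assumes "\<pi> permutes UNIV"
  shows "lborel = distr lborel borel (\<lambda>x::real^'n. \<chi> i. x $ \<pi> i)"
proof (rule lborel_eqI)
  let ?f = "\<lambda>x::real^'n. \<chi> i. x $ \<pi> i"
  have meas [measurable]: "?f \<in> borel_measurable borel"
    by (intro borel_measurable_continuous_onI continuous_intros)
  fix l u :: "real^'n"
  assume le: "\<And>b. b \<in> Basis \<Longrightarrow> l \<bullet> b \<le> u \<bullet> b"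
  have bij: "bij \<pi>" using assms by (rule permutes_bij)
  let ?\<rho> = "inv \<pi>"
  \<comment> \<open>The bounds on \<open>x $ \<pi> i\<close> are reindexed by the coordinate they
    constrain, hence the inverse permutation.\<close>
  have vimage: "?f -` box l u = box (\<chi> i. l $ ?\<rho> i) (\<chi> i. u $ ?\<rho> i)"
    by (auto simp: mem_box_cart) (metis bij bij_inv_eq_iff)+
  have le': "l $ i \<le> u $ i" for i
    using le[of "axis i 1"] by (simp add: axis_in_Basis_iff inner_axis)
  have "emeasure (distr lborel borel ?f) (box l u) = emeasure lborel (box (\<chi> i. l $ ?\<rho> i) (\<chi> i. u $ ?\<rho> i))"
    by (subst emeasure_distr) (auto simp: vimage)
  also have "\<dots> = (\<Prod>b\<in>Basis. ((\<chi> i. u $ ?\<rho> i) - (\<chi> i. l $ ?\<rho> i)) \<bullet> b)"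
    by (rule emeasure_lborel_box) (use le' in \<open>auto simp: Basis_vec_def inner_axis\<close>)
  also have "\<dots> = (\<Prod>i\<in>UNIV. (u - l) $ ?\<rho> i)"
    by (simp add: prod_Basis_cart inner_axis)
  also have "\<dots> = (\<Prod>i\<in>UNIV. (u - l) $ i)"
    by (subst prod.reindex_bij_betw[OF bij_imp_bij_inv[OF bij]]) simp
  finally show "emeasure (distr lborel borel ?f) (box l u) = (\<Prod>b\<in>Basis. (u - l) \<bullet> b)"
    by (simp add: prod_Basis_cart inner_axis)
qed simp

text \<open>
  The library version of this result requires the index type to be well-ordered.
\<close>
lemma nn_integral_lborel_linear:
  fixes f :: "real^'n \<Rightarrow> real^'n"
  assumes "linear f" "det (matrix f) \<noteq> 0" "h \<in> borel_measurable borel"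
  shows "(\<integral>\<^sup>+x. h x \<partial>lborel) = ennreal \<bar>det (matrix f)\<bar> * (\<integral>\<^sup>+x. h (f x) \<partial>lborel)"
proof -
  have meas: "g \<in> borel_measurable borel" if "linear g" for g :: "real^'n \<Rightarrow> real^'n"
    using that by (intro borel_measurable_continuous_onI linear_continuous_on linear_conv_bounded_linear[THEN iffD1])
  \<comment> \<open>Quantifying over all \<open>h\<close> lets the composition case apply the
    hypothesis for \<open>g\<close> to the function \<open>h\<close> after \<open>f\<close>. The
    determinant condition is a premise of the implication because the induction also passes through
    singular maps.\<close>
  have "det (matrix f) \<noteq> 0 \<longrightarrow> (\<forall>h\<in>borel_measurable borel.
      (\<integral>\<^sup>+x. h x \<partial>lborel) = ennreal \<bar>det (matrix f)\<bar> * (\<integral>\<^sup>+x. h (f x) \<partial>lborel))"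
    (is "?P f")
    using assms(1)
  proof (rule induct_linear_elementary)
    fix f g :: "real^'n \<Rightarrow> real^'n"
    assume lin: "linear f" "linear g" and P: "?P f" "?P g"
    have det: "det (matrix (f \<circ> g)) = det (matrix f) * det (matrix g)"
      using lin by (simp add: matrix_compose det_mul)
    show "?P (f \<circ> g)"
    proof (intro impI ballI)
      fix h :: "real^'n \<Rightarrow> ennreal"
      assume nz: "det (matrix (f \<circ> g)) \<noteq> 0" and h: "h \<in> borel_measurable borel"
      have "(\<integral>\<^sup>+x. h x \<partial>lborel) = ennreal \<bar>det (matrix f)\<bar> * (\<integral>\<^sup>+x. h (f x) \<partial>lborel)"
        using P(1) nz h by (simp add: det)
      also have "(\<integral>\<^sup>+x. h (f x) \<partial>lborel) = ennreal \<bar>det (matrix g)\<bar> * (\<integral>\<^sup>+x. h (f (g x)) \<partial>lborel)"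
        using P(2) nz measurable_compose[OF meas[OF lin(1)] h] by (simp add: det)
      finally show "(\<integral>\<^sup>+x. h x \<partial>lborel)
          = ennreal \<bar>det (matrix (f \<circ> g))\<bar> * (\<integral>\<^sup>+x. h ((f \<circ> g) x) \<partial>lborel)"
        by (simp add: det abs_mult ennreal_mult mult.assoc)
    qed
  next
    fix f :: "real^'n \<Rightarrow> real^'n" and i
    assume "linear f" "\<And>x. f x $ i = 0"
    \<comment> \<open>A map with a vanishing coordinate has determinant 0, so its case is
      vacuous.\<close>
    then have "row i (matrix f) = 0"
      by (simp add: row_def matrix_def vec_eq_iff)
    then show "?P f"
      using det_zero_row[of i "matrix f"] by simp
  next
    fix c :: "'n \<Rightarrow> real"
    let ?f = "\<lambda>x::real^'n. \<chi> i. c i * x $ i"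
    have det: "det (matrix ?f) = prod c UNIV"
      by (subst det_diagonal) (auto simp: matrix_def axis_def)
    show "?P ?f"
    proof (intro impI ballI)
      fix h :: "real^'n \<Rightarrow> ennreal"
      assume nz: "det (matrix ?f) \<noteq> 0" and h [measurable]: "h \<in> borel_measurable borel"
      have c: "c i \<noteq> 0" for i
        using nz by (auto simp: det)
      \<comment> \<open>\<open>lborel_affine_euclidean\<close> indexes the scaling factors by basis
        vectors; the choice recovers the index, which is unique because \<open>axis\<close> is
        injective in it.\<close>
      define c' where "c' b = c (SOME i. b = axis i 1)" for b :: "real^'n"
      have c': "c' (axis i 1) = c i" for i
        unfolding c'_def by (rule arg_cong[of _ _ c]) (auto simp: axis_eq_axis)
      have f: "0 + (\<Sum>b\<in>Basis. (c' b * (x \<bullet> b)) *\<^sub>R b) = ?f x" for x :: "real^'n"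
      proof -
        have "(\<Sum>b\<in>Basis. (c' b * (x \<bullet> b)) *\<^sub>R b) = (\<Sum>i\<in>UNIV. (c i * x $ i) *\<^sub>R axis i 1)"
          unfolding Basis_eq_range_axis by (subst sum.reindex[OF inj_axis]) (simp add: c' inner_axis)
        then show ?thesis
          by (simp add: vec_eq_iff axis_def if_distrib cong: if_cong)
      qed
      have [measurable]: "?f \<in> borel_measurable borel"
        by (intro borel_measurable_continuous_onI continuous_intros)
      have "lborel = density (distr lborel borel (\<lambda>x. 0 + (\<Sum>b\<in>Basis. (c' b * (x \<bullet> b)) *\<^sub>R b)))
          (\<lambda>_. ennreal (\<Prod>b\<in>Basis. \<bar>c' b\<bar>))"
        by (rule lborel_affine_euclidean) (use c c' in \<open>auto simp: Basis_eq_range_axis\<close>)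
      also have "(\<Prod>b\<in>Basis. \<bar>c' b\<bar>) = \<bar>prod c UNIV\<bar>"
        by (simp add: prod_Basis_cart c' abs_prod)
      finally have "lborel = density (distr lborel borel ?f) (\<lambda>_. ennreal \<bar>prod c UNIV\<bar>)"
        unfolding f .
      then have "(\<integral>\<^sup>+x. h x \<partial>lborel) = (\<integral>\<^sup>+x. h x \<partial>density (distr lborel borel ?f) (\<lambda>_. ennreal \<bar>prod c UNIV\<bar>))"
        by simp
      then show "(\<integral>\<^sup>+x. h x \<partial>lborel) = ennreal \<bar>det (matrix ?f)\<bar> * (\<integral>\<^sup>+x. h (?f x) \<partial>lborel)"
        by (simp add: det nn_integral_density nn_integral_distr nn_integral_cmult)
    qed
  next
    fix m n :: 'n
    assume "m \<noteq> n"
    let ?\<tau> = "Transposition.transpose m n"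
    let ?f = "\<lambda>x::real^'n. \<chi> i. x $ ?\<tau> i"
    have perm: "?\<tau> permutes UNIV"
      by (rule permutes_swap_id) auto
    have "matrix ?f = (\<chi> i. mat 1 $ ?\<tau> i)"
      by (auto simp: matrix_def mat_def axis_def vec_eq_iff)
    \<comment> \<open>The matrix is the identity with permuted rows, so its determinant is a
      sign.\<close>
    then have det: "\<bar>det (matrix ?f)\<bar> = 1"
      using det_permute_rows[OF perm, of "mat 1 :: real^'n^'n"] by (simp add: sign_def)
    have [measurable]: "?f \<in> borel_measurable borel"
      by (intro borel_measurable_continuous_onI continuous_intros)
    show "?P ?f"
      unfolding det by (subst (1) lborel_distr_permute[OF perm]) (auto simp: nn_integral_distr)
  next
    fix m n :: 'n
    assume mn: "m \<noteq> n"
    let ?f = "\<lambda>x::real^'n. \<chi> i. if i = m then x $ m + x $ n else x $ i"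
    have "matrix ?f = (\<chi> k. if k = m then row m (mat 1) + 1 *s row n (mat 1) else row k (mat 1))"
      by (auto simp: matrix_def mat_def axis_def vec_eq_iff row_def)
    then have det: "det (matrix ?f) = 1"
      using det_row_operation[OF mn, of "mat 1 :: real^'n^'n" 1] by simp
    \<comment> \<open>Adding one coordinate to another is exactly the shear of
      \<open>nn_integral_lborel_shear\<close>.\<close>
    have f: "?f x = x + (x \<bullet> axis n 1) *\<^sub>R axis m 1" for x
      by (simp add: vec_eq_iff inner_axis) (simp add: axis_def)
    have "axis m 1 \<in> (Basis :: (real^'n) set)" "axis n 1 \<in> (Basis :: (real^'n) set)"
      "axis m 1 \<noteq> (axis n 1 :: real^'n)"
      using mn by (simp_all add: axis_in_Basis_iff axis_eq_axis)
    from nn_integral_lborel_shear[OF this] show "?P ?f"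
      unfolding det unfolding f by simp
  qed
  then show ?thesis using assms by blast
qed

text \<open>Lebesgue measure is its own image under \<open>z \<mapsto> m + N *v z\<close> weighted
  by the Jacobian. This form carries integrability along with the value of the integral.\<close>

lemma has_bochner_integral_lborel_affine:
  fixes N :: "real^'n^'n" and g :: "real^'n \<Rightarrow> real"
  assumes N: "det N \<noteq> 0" and g [measurable]: "g \<in> borel_measurable borel"
    and I: "has_bochner_integral lborel (\<lambda>z. \<bar>det N\<bar> * g (m + N *v z)) I"
  shows "has_bochner_integral lborel g I"
proof -
  let ?D = "density (distr lborel borel (\<lambda>z. m + N *v z)) (\<lambda>_. ennreal \<bar>det N\<bar>)"
  have "lborel = ?D"
  proof (rule measure_eqI)
    fix X assume "X \<in> sets (lborel :: (real^'n) measure)"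
    then have X [measurable]: "X \<in> sets borel" by simp
    \<comment> \<open>Measures of sets are integrals of indicators, so translation invariance
      followed by the linear substitution gives equality of the two measures.\<close>
    have "emeasure lborel X = (\<integral>\<^sup>+x. indicator X x \<partial>distr lborel borel ((+) m))"
      by (simp add: lborel_distr_plus)
    also have "\<dots> = (\<integral>\<^sup>+x. indicator X (m + x) \<partial>lborel)"
      by (rule nn_integral_distr) auto
    also have "\<dots> = ennreal \<bar>det N\<bar> * (\<integral>\<^sup>+x. indicator X (m + N *v x) \<partial>lborel)"
      using nn_integral_lborel_linear[of "(*v) N" "\<lambda>x. indicator X (m + x)"] N by simp
    also have "(\<integral>\<^sup>+x. indicator X (m + N *v x) \<partial>lborel)
        = (\<integral>\<^sup>+x. indicator X x \<partial>distr lborel borel (\<lambda>z. m + N *v z))"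
      by (rule nn_integral_distr[symmetric]) auto
    also have "ennreal \<bar>det N\<bar> * \<dots> = emeasure ?D X"
      by (simp add: emeasure_density nn_integral_cmult)
    finally show "emeasure lborel X = emeasure ?D X" .
  qed simp
  moreover have "has_bochner_integral (distr lborel borel (\<lambda>z. m + N *v z)) (\<lambda>x. \<bar>det N\<bar> * g x) I"
    using I by (intro has_bochner_integral_distr) auto
  then have "has_bochner_integral ?D g I"
    by (intro has_bochner_integral_density) auto
  ultimately show ?thesis by simp
qed

section \<open>Moments of the standard Gaussian\<close>


text \<open>Lebesgue measure is the image of a product measure, over which a product of one-variable
  functions integrates factor by factor.\<close>

lemma has_bochner_integral_lborel_prod:
  fixes f :: "'n::finite \<Rightarrow> real \<Rightarrow> real"
  assumes "\<And>i. has_bochner_integral lborel (f i) (c i)"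
  shows "has_bochner_integral lborel (\<lambda>x::real^'n. \<Prod>i\<in>UNIV. f i (x $ i)) (\<Prod>i\<in>UNIV. c i)"
proof -
  interpret product_sigma_finite "\<lambda>_::real^'n. lborel :: real measure" ..
  \<comment> \<open>The product measure is indexed by basis vectors; \<open>k\<close> translates
    them back to coordinate indices.\<close>
  define k where "k b = inv (\<lambda>i. axis i 1 :: real^'n) b" for b
  have k: "k (axis i 1) = i" for i
    unfolding k_def by (rule inv_f_f[OF inj_axis])
  have int: "integrable lborel (f i)" and c: "integral\<^sup>L lborel (f i) = c i" for i
    using assms[of i] by (auto simp: has_bochner_integral_iff)
  have [measurable]: "f i \<in> borel_measurable borel" for i
    using borel_measurable_integrable[OF int[of i]] by simp
  have "has_bochner_integral (Pi\<^sub>M Basis (\<lambda>_. lborel)) (\<lambda>y. \<Prod>b\<in>Basis. f (k b) (y b)) (\<Prod>b\<in>Basis. c (k b))"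
    unfolding has_bochner_integral_iff
    using product_integrable_prod[of Basis "\<lambda>b. f (k b)"] product_integral_prod[of Basis "\<lambda>b. f (k b)"] int c
    by auto
  also have "(\<Prod>b\<in>Basis. c (k b)) = (\<Prod>i\<in>UNIV. c i)"
    by (simp add: prod_Basis_cart k)
  also have "(\<lambda>y. \<Prod>b\<in>Basis. f (k b) (y b))
      = (\<lambda>y. \<Prod>i\<in>UNIV. f i ((\<Sum>b\<in>Basis. y b *\<^sub>R b :: real^'n) $ i))"
  proof
    fix y :: "real^'n \<Rightarrow> real"
    have "(\<Sum>b\<in>Basis. y b *\<^sub>R b) $ i = y (axis i 1)" for i
      using inner_sum_left_Basis[of "axis i 1 :: real^'n" y]
      by (simp add: axis_in_Basis_iff inner_axis)
    then show "(\<Prod>b\<in>Basis. f (k b) (y b)) = (\<Prod>i\<in>UNIV. f i ((\<Sum>b\<in>Basis. y b *\<^sub>R b :: real^'n) $ i))"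
      by (simp add: prod_Basis_cart k)
  qed
  finally show ?thesis
    by (subst lborel_eq, intro has_bochner_integral_distr) auto
qed

text \<open>The product form makes every moment factor into one-dimensional moments.\<close>

definition std_gaussian :: "real^'n \<Rightarrow> real" where
  "std_gaussian z = (\<Prod>i\<in>UNIV. std_normal_density (z $ i))"

text \<open>This closed form is what \<open>gaussian_density\<close> is compared with after the
  substitution.\<close>

lemma std_gaussian_eq:
  "std_gaussian (z :: real^'n) = (2 * pi) powr (- (CARD('n) / 2)) * exp (- (z \<bullet> z) / 2)"
proof -
  have "std_gaussian z = (\<Prod>i\<in>(UNIV::'n set). 1 / sqrt (2 * pi)) * (\<Prod>i\<in>UNIV. exp (- (z $ i)\<^sup>2 / 2))"
    unfolding std_gaussian_def std_normal_density_def by (rule prod.distrib)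
  also have "(\<Prod>i\<in>(UNIV::'n set). 1 / sqrt (2 * pi)) = (2 * pi) powr (- (CARD('n) / 2))"
  proof -
    have "1 / sqrt (2 * pi) = (2 * pi) powr (- 1 / 2)"
      by (simp add: powr_minus_divide powr_half_sqrt)
    then show ?thesis
      by (simp add: powr_power)
  qed
  also have "(\<Prod>i\<in>UNIV. exp (- (z $ i)\<^sup>2 / 2)) = exp (- (z \<bullet> z) / 2)"
    by (simp add: exp_sum[symmetric] inner_vec_def sum_negf sum_divide_distrib power2_eq_square)
  finally show ?thesis .
qed

lemma std_gaussian_integral: "has_bochner_integral lborel (std_gaussian :: real^'n \<Rightarrow> real) 1"
  using has_bochner_integral_lborel_prod[of "\<lambda>_. std_normal_density" "\<lambda>_::'n. 1"]
  by (simp add: std_gaussian_def[abs_def] has_bochner_integral_iff)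

lemma std_normal_first_moment: "has_bochner_integral lborel (\<lambda>x. std_normal_density x * x) 0"
  using std_normal_moment_odd[of 0] by simp

lemma std_normal_second_moment: "has_bochner_integral lborel (\<lambda>x. std_normal_density x * x\<^sup>2) 1"
  using std_normal_moment_even[of 1] by (simp add: fact_numeral)

text \<open>Placing \<open>z $ i\<close> into the \<open>i\<close>-th factor keeps the integrand a
  product; that factor has integral 0.\<close>

lemma std_gaussian_first_moment:
  "has_bochner_integral lborel (\<lambda>z::real^'n. std_gaussian z * z $ i) 0"
proof -
  have 1: "has_bochner_integral lborel (\<lambda>x. std_normal_density x * (if j = i then x else 1))
      (if j = i then 0 else 1)" for j
    using std_normal_first_moment by (cases "j = i") (auto simp: has_bochner_integral_iff)
  have 2: "(\<Prod>j\<in>UNIV. std_normal_density (z $ j) * (if j = i then z $ j else 1))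
      = std_gaussian z * z $ i" for z :: "real^'n"
    by (simp add: std_gaussian_def prod.distrib)
  show ?thesis
    using has_bochner_integral_lborel_prod[of "\<lambda>j x. std_normal_density x * (if j = i then x else 1)"
        "\<lambda>j. if j = i then 0 else 1", OF 1] by (simp add: 2)
qed

text \<open>On the diagonal one factor becomes a second moment, which is 1. Off the diagonal two
  factors become first moments, which are 0.\<close>

lemma std_gaussian_second_moment:
  "has_bochner_integral lborel (\<lambda>z::real^'n. std_gaussian z * (z $ i * z $ j)) (of_bool (i = j))"
proof (cases "i = j")
  case True
  have 1: "has_bochner_integral lborel (\<lambda>x. std_normal_density x * (if k = i then x\<^sup>2 else 1)) 1" for k
    using std_normal_second_moment by (cases "k = i") (auto simp: has_bochner_integral_iff)
  have 2: "(\<Prod>k\<in>UNIV. std_normal_density (z $ k) * (if k = i then (z $ k)\<^sup>2 else 1))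
      = std_gaussian z * (z $ i * z $ j)" for z :: "real^'n"
    by (simp add: std_gaussian_def prod.distrib True power2_eq_square)
  show ?thesis
    using has_bochner_integral_lborel_prod[of "\<lambda>k x. std_normal_density x * (if k = i then x\<^sup>2 else 1)"
        "\<lambda>_. 1", OF 1]
    unfolding 2 using True by simp
next
  case False
  have 1: "has_bochner_integral lborel
      (\<lambda>x. std_normal_density x * ((if k = i then x else 1) * (if k = j then x else 1)))
      (if k = i then 0 else if k = j then 0 else 1)" for k
    using std_normal_first_moment False
    by (cases "k = i"; cases "k = j") (auto simp: has_bochner_integral_iff)
  have 2: "(\<Prod>k\<in>UNIV. std_normal_density (z $ k) * ((if k = i then z $ k else 1) * (if k = j then z $ k else 1)))
      = std_gaussian z * (z $ i * z $ j)" for z :: "real^'n"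
    by (simp add: std_gaussian_def prod.distrib)
  have 3: "(\<Prod>k\<in>UNIV. if k = i then 0 else if k = j then 0 else 1) = (of_bool (i = j) :: real)"
    using False by (auto intro!: prod_zero)
  show ?thesis
    using has_bochner_integral_lborel_prod[of
        "\<lambda>k x. std_normal_density x * ((if k = i then x else 1) * (if k = j then x else 1))"
        "\<lambda>k. if k = i then 0 else if k = j then 0 else 1", OF 1]
    unfolding 2 3 .
qed

text \<open>After expansion the terms linear in \<open>z\<close> have mean zero, and the identity
  covariance turns the quadratic term into \<open>v \<bullet> w\<close>.\<close>

lemma std_gaussian_affine_product:
  fixes v w :: "real^'n"
  shows "has_bochner_integral lborel (\<lambda>z. std_gaussian z * ((a + v \<bullet> z) * (b + w \<bullet> z))) (a * b + v \<bullet> w)"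
proof -
  have lin: "has_bochner_integral lborel (\<lambda>z. std_gaussian z * (v \<bullet> z)) 0" for v :: "real^'n"
  proof -
    have "has_bochner_integral lborel (\<lambda>z. \<Sum>i\<in>UNIV. v $ i * (std_gaussian z * z $ i)) (\<Sum>i\<in>UNIV. v $ i * 0)"
      by (intro has_bochner_integral_sum has_bochner_integral_mult_right std_gaussian_first_moment)
    then show ?thesis
      by (simp add: inner_vec_def sum_distrib_left mult.left_commute)
  qed
  have "has_bochner_integral lborel
      (\<lambda>z. \<Sum>i\<in>UNIV. \<Sum>j\<in>UNIV. v $ i * w $ j * (std_gaussian z * (z $ i * z $ j)))
      (\<Sum>i\<in>UNIV. \<Sum>j\<in>UNIV. v $ i * w $ j * of_bool (i = j))"
    by (intro has_bochner_integral_sum has_bochner_integral_mult_right std_gaussian_second_moment)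
  also have "(\<lambda>z. \<Sum>i\<in>UNIV. \<Sum>j\<in>UNIV. v $ i * w $ j * (std_gaussian z * (z $ i * z $ j)))
      = (\<lambda>z. std_gaussian z * ((v \<bullet> z) * (w \<bullet> z)))"
    unfolding fun_eq_iff inner_vec_def sum_product unfolding sum_distrib_left
    by (auto intro!: sum.cong)
  also have "(\<Sum>i\<in>UNIV. \<Sum>j\<in>UNIV. v $ i * w $ j * of_bool (i = j)) = v \<bullet> w"
    by (simp add: inner_vec_def)
  finally have quad: "has_bochner_integral lborel (\<lambda>z. std_gaussian z * ((v \<bullet> z) * (w \<bullet> z))) (v \<bullet> w)" .
  have "has_bochner_integral lborel
      (\<lambda>z. a * b * std_gaussian z + a * (std_gaussian z * (w \<bullet> z)) + b * (std_gaussian z * (v \<bullet> z))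
         + std_gaussian z * ((v \<bullet> z) * (w \<bullet> z)))
      (a * b * 1 + a * 0 + b * 0 + v \<bullet> w)"
    by (intro has_bochner_integral_add has_bochner_integral_mult_right std_gaussian_integral lin quad)
  then show ?thesis
    by (simp add: algebra_simps)
qed

section \<open>Gaussians with positive definite covariance\<close>


lemma matrix_inv_unique:
  fixes A B :: "real^'n^'n"
  assumes "A ** B = mat 1"
  shows "matrix_inv A = B"
proof -
  have BA: "B ** A = mat 1" using assms by (simp add: matrix_left_right_inverse)
  have "A ** matrix_inv A = mat 1 \<and> matrix_inv A ** A = mat 1"
    unfolding matrix_inv_def by (rule someI[of _ B]) (use assms BA in simp)
  then have "matrix_inv A = matrix_inv A ** (A ** B)" "matrix_inv A ** A = mat 1"
    using assms by simp_all
  then show ?thesis by (metis matrix_mul_assoc matrix_mul_lid)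
qed

lemma bilinear_matrix_symmetric:
  fixes S :: "real^'n^'n"
  assumes "transpose S = S"
  shows "v \<bullet> (S *v w) = w \<bullet> (S *v v)"
  by (metis assms dot_lmul_matrix inner_commute transpose_matrix_vector)

text \<open>Gram-Schmidt for the inner product \<open>v \<bullet> (S *v w)\<close>, adding one
  vector at a time.\<close>

lemma pos_def_orthonormal_set:
  fixes S :: "real^'n^'n"
  assumes S: "pos_def_matrix S" and "k \<le> CARD('n)"
  shows "\<exists>V. finite V \<and> card V = k \<and> (\<forall>v\<in>V. \<forall>w\<in>V. v \<bullet> (S *v w) = of_bool (v = w))"
  using assms(2)
proof (induction k)
  case (Suc k)
  then obtain V where V: "finite V" "card V = k" "\<And>v w. v \<in> V \<Longrightarrow> w \<in> V \<Longrightarrow> v \<bullet> (S *v w) = of_bool (v = w)"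
    by auto
  \<comment> \<open>Fewer than n vectors \<open>S *v v\<close> cannot span the space. A vector
    orthogonal to all of them in the usual sense is \<open>S\<close>-orthogonal to
    \<open>V\<close>.\<close>
  have "dim (span ((*v) S ` V)) \<le> card ((*v) S ` V)"
    using V(1) by (simp add: dim_le_card')
  also have "\<dots> \<le> card V" by (rule card_image_le[OF V(1)])
  also have "\<dots> < DIM(real^'n)" using Suc.prems V(2) by simp
  finally obtain x where x: "x \<noteq> 0" "\<And>y. y \<in> span ((*v) S ` V) \<Longrightarrow> orthogonal x y"
    using orthogonal_to_subspace_exists by (metis dim_span)
  have pos: "x \<bullet> (S *v x) > 0"
    using S x(1) by (simp add: pos_def_matrix_def)
  define c where "c = 1 / sqrt (x \<bullet> (S *v x))"
  have c: "c * c * (x \<bullet> (S *v x)) = 1"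
    using pos by (simp add: c_def)
  define x' where "x' = c *\<^sub>R x"
  have x'x': "x' \<bullet> (S *v x') = 1"
    using c by (simp add: x'_def matrix_vector_mult_scaleR)
  have x'V: "x' \<bullet> (S *v v) = 0" if "v \<in> V" for v
    using x(2)[of "S *v v"] that by (simp add: x'_def orthogonal_def span_base)
  have Vx': "v \<bullet> (S *v x') = 0" if "v \<in> V" for v
    using x'V[OF that] S by (simp add: bilinear_matrix_symmetric[of S v x'] pos_def_matrix_def)
  \<comment> \<open>Otherwise the \<open>S\<close>-norm of \<open>x'\<close> would be both 1 and 0.
    Hence the cardinality really grows by one.\<close>
  have "x' \<notin> V" using x'V x'x' by force
  then show ?case
    using V x'x' x'V Vx' by (intro exI[of _ "insert x' V"]) auto
qed (auto intro: exI[of _ "{}"])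

text \<open>If the rows of \<open>Q\<close> form an \<open>S\<close>-orthonormal basis, then
  \<open>Q ** S ** transpose Q\<close> is the identity. Hence \<open>N = S ** transpose Q\<close>
  inverts \<open>Q\<close>, and it serves as a square root of \<open>S\<close>.\<close>

lemma pos_def_factorization:
  fixes S :: "real^'n^'n"
  assumes S: "pos_def_matrix S"
  obtains N Q :: "real^'n^'n" where "N ** transpose N = S" "Q ** N = mat 1" "N ** Q = mat 1" "matrix_inv S = transpose Q ** Q"
proof -
  obtain V where V: "finite V" "card V = CARD('n)" "\<And>v w. v \<in> V \<Longrightarrow> w \<in> V \<Longrightarrow> v \<bullet> (S *v w) = of_bool (v = w)"
    using pos_def_orthonormal_set[OF S, of "CARD('n)"] by auto
  obtain b :: "'n \<Rightarrow> real^'n" where b: "bij_betw b UNIV V"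
    using finite_same_card_bij[of "UNIV :: 'n set" V] V by auto
  define Q where "Q = (\<chi> i. b i)"
  have "(Q ** S ** transpose Q) $ i $ j = b i \<bullet> (S *v b j)" for i j
    by (simp add: Q_def matrix_mul_assoc[symmetric])
       (simp add: matrix_matrix_mult_def matrix_vector_mult_def inner_vec_def transpose_def)
  moreover have "b i \<bullet> (S *v b j) = of_bool (i = j)" for i j
    using V(3)[of "b i" "b j"] b by (auto simp: bij_betw_def inj_on_eq_iff)
  ultimately have QSQ: "Q ** (S ** transpose Q) = mat 1"
    by (simp add: vec_eq_iff mat_def matrix_mul_assoc)
  define N where "N = S ** transpose Q"
  have QN: "Q ** N = mat 1" using QSQ by (simp add: N_def)
  then have NQ: "N ** Q = mat 1" by (simp add: matrix_left_right_inverse)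
  have "transpose N = Q ** S"
    using S by (simp add: N_def matrix_transpose_mul pos_def_matrix_def)
  then have NN: "N ** transpose N = S"
    using NQ by (simp add: matrix_mul_assoc)
  have "S ** (transpose Q ** Q) = mat 1"
    using NQ by (simp add: N_def matrix_mul_assoc)
  then have "matrix_inv S = transpose Q ** Q" by (rule matrix_inv_unique)
  with QN NQ NN that show ?thesis by blast
qed

lemma pos_def_matrix_inv:
  fixes S :: "real^'n^'n"
  assumes "pos_def_matrix S"
  shows "S ** matrix_inv S = mat 1" "transpose (matrix_inv S) = matrix_inv S"
proof -
  obtain N Q :: "real^'n^'n" where *: "N ** transpose N = S" "Q ** N = mat 1" "N ** Q = mat 1" "matrix_inv S = transpose Q ** Q"
    by (rule pos_def_factorization[OF assms])
  have "transpose N ** transpose Q = mat 1"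
    using *(2) by (metis matrix_transpose_mul transpose_mat)
  then show "S ** matrix_inv S = mat 1"
    using * by (metis matrix_mul_assoc matrix_mul_lid)
  show "transpose (matrix_inv S) = matrix_inv S"
    by (simp add: * matrix_transpose_mul)
qed

section \<open>The Gaussian density: standardization, moments and partial derivatives\<close>

lemma det_scaleR_matrix: "det (c *\<^sub>R (S :: real^'n^'n)) = c ^ CARD('n) * det S"
proof -
  have "c *\<^sub>R S = (\<chi> i. c *s S $ i)" by (simp add: vec_eq_iff)
  then show ?thesis
    using det_rows_mul[of "\<lambda>_. c" "\<lambda>i. S $ i"] by simp
qed

text \<open>The quadratic form becomes the squared norm of \<open>Q *v (N *v z) = z\<close>, and the
  Jacobian cancels the root of \<open>det S\<close>, which is the square of
  \<open>det N\<close>.\<close>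

lemma gaussian_density_pullback:
  fixes S N Q :: "real^'n^'n"
  assumes NN: "N ** transpose N = S" and QN: "Q ** N = mat 1" and inv: "matrix_inv S = transpose Q ** Q"
  shows "\<bar>det N\<bar> * gaussian_density m S (m + N *v z) = std_gaussian z"
proof -
  have dN: "det N \<noteq> 0"
    using QN by (metis det_I det_mul mult_zero_right zero_neq_one)
  have "(N *v z) \<bullet> (matrix_inv S *v (N *v z)) = (Q *v (N *v z)) \<bullet> (Q *v (N *v z))"
    unfolding inv matrix_vector_mul_assoc[symmetric]
    by (metis dot_lmul_matrix inner_commute transpose_matrix_vector)
  also have "Q *v (N *v z) = z"
    by (simp add: matrix_vector_mul_assoc QN)
  finally have quad: "(N *v z) \<bullet> (matrix_inv S *v (N *v z)) = z \<bullet> z" .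
  \<comment> \<open>Writing the square as \<open>\<bar>det N\<bar> powr 2\<close> lets
    \<open>powr_powr\<close> take the root without a sign question.\<close>
  have "det ((2 * pi) *\<^sub>R S) = (2 * pi) powr CARD('n) * (\<bar>det N\<bar> powr 2)"
    using dN by (simp add: det_scaleR_matrix NN[symmetric] det_mul powr_realpow power2_eq_square)
  then have "det ((2 * pi) *\<^sub>R S) powr (- 1 / 2) = (2 * pi) powr (- (CARD('n) / 2)) * \<bar>det N\<bar> powr (- 1)"
    by (simp only: powr_mult powr_powr) simp
  moreover have "\<bar>det N\<bar> * \<bar>det N\<bar> powr (- 1) = 1"
    using dN by (simp add: powr_minus)
  ultimately show ?thesis
    by (simp add: gaussian_density_def std_gaussian_eq quad dN)
qed

lemma gaussian_density_pos:
  assumes "pos_def_matrix S"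
  shows "gaussian_density m S x > 0"
proof -
  \<comment> \<open>A real \<open>powr\<close> vanishes only at base 0, so a nonzero determinant
    suffices for positivity.\<close>
  have "det S \<noteq> 0"
    using pos_def_matrix_inv(1)[OF assms] by (metis det_I det_mul mult_zero_left zero_neq_one)
  then show ?thesis
    by (simp add: gaussian_density_def det_scaleR_matrix)
qed

lemma borel_measurable_gaussian_density [measurable]:
  "gaussian_density m S \<in> borel_measurable borel"
  unfolding gaussian_density_def by measurable

text \<open>Under \<open>x = m + N *v z\<close> the functional \<open>v\<close> becomes
  \<open>transpose N *v v\<close>, and the inner product of two such vectors is the covariance form
  of \<open>S\<close>. Both entropy integrals are instances.\<close>

lemma gaussian_affine_product_expectation:
  fixes S :: "real^'n^'n"
  assumes S: "pos_def_matrix S"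
  shows "has_bochner_integral lborel
    (\<lambda>x. gaussian_density m S x * ((a + v \<bullet> (x - m)) * (b + w \<bullet> (x - m)))) (a * b + v \<bullet> (S *v w))"
proof -
  obtain N Q :: "real^'n^'n" where N: "N ** transpose N = S" "Q ** N = mat 1" "N ** Q = mat 1" "matrix_inv S = transpose Q ** Q"
    by (rule pos_def_factorization[OF S])
  have dN: "det N \<noteq> 0"
    using N(2) by (metis det_I det_mul mult_zero_right zero_neq_one)
  have adj: "u \<bullet> (N *v z) = (transpose N *v u) \<bullet> z" for u z
    by (simp add: dot_lmul_matrix transpose_matrix_vector)
  have cov: "(transpose N *v v) \<bullet> (transpose N *v w) = v \<bullet> (S *v w)"
    by (simp only: adj[symmetric] matrix_vector_mul_assoc N)
  have pull: "\<bar>det N\<bar> * (gaussian_density m S (m + N *v z) *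
      ((a + v \<bullet> (m + N *v z - m)) * (b + w \<bullet> (m + N *v z - m))))
      = std_gaussian z * ((a + (transpose N *v v) \<bullet> z) * (b + (transpose N *v w) \<bullet> z))" for z
    unfolding mult.assoc[symmetric] gaussian_density_pullback[OF N(1,2,4)] add_diff_cancel_left' adj ..
  have "has_bochner_integral lborel (\<lambda>z. \<bar>det N\<bar> * (gaussian_density m S (m + N *v z) *
      ((a + v \<bullet> (m + N *v z - m)) * (b + w \<bullet> (m + N *v z - m))))) (a * b + v \<bullet> (S *v w))"
    unfolding pull cov[symmetric] by (rule std_gaussian_affine_product)
  then show ?thesis
    by (rule has_bochner_integral_lborel_affine[OF dN, rotated]) measurable
qed

text \<open>Along a coordinate line the exponent is a quadratic polynomial in \<open>s\<close>, and
  only its linear coefficient contributes at 0. Symmetry of the inverse merges the two cross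
  terms.\<close>

lemma partial_deriv_gaussian_density:
  fixes S :: "real^'n^'n"
  assumes S: "pos_def_matrix S"
  shows "partial_deriv j (gaussian_density m S) x
    = - ((matrix_inv S *v (x - m)) $ j) * gaussian_density m S x"
proof -
  let ?R = "matrix_inv S" and ?e = "axis j 1 :: real^'n" and ?y = "x - m"
  define C where "C = det ((2 * pi) *\<^sub>R S) powr (- 1 / 2)"
  have sym: "?e \<bullet> (?R *v ?y) = ?y \<bullet> (?R *v ?e)"
    by (rule bilinear_matrix_symmetric[OF pos_def_matrix_inv(2)[OF S]])
  have eq: "gaussian_density m S (x + s *\<^sub>R ?e)
      = C * exp (- (1/2) * (?y \<bullet> (?R *v ?y) + 2 * s * ((?R *v ?y) $ j) + s\<^sup>2 * (?e \<bullet> (?R *v ?e))))" for s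
  proof -
    have shift: "x + s *\<^sub>R ?e - m = ?y + s *\<^sub>R ?e" by simp
    have "(?y + s *\<^sub>R ?e) \<bullet> (?R *v (?y + s *\<^sub>R ?e))
        = ?y \<bullet> (?R *v ?y) + 2 * s * (?e \<bullet> (?R *v ?y)) + s\<^sup>2 * (?e \<bullet> (?R *v ?e))"
      unfolding matrix_vector_right_distrib matrix_vector_mult_scaleR inner_add_left inner_add_right
        inner_scaleR_left inner_scaleR_right sym[symmetric]
      by (simp add: algebra_simps power2_eq_square)
    moreover have "?e \<bullet> (?R *v ?y) = (?R *v ?y) $ j"
      by (simp add: inner_axis')
    ultimately show ?thesis
      unfolding gaussian_density_def C_def shift by simp
  qed
  have "((\<lambda>s. C * exp (- (1/2) * (?y \<bullet> (?R *v ?y) + 2 * s * ((?R *v ?y) $ j) + s\<^sup>2 * (?e \<bullet> (?R *v ?e)))))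
      has_real_derivative - ((?R *v ?y) $ j) * (C * exp (- (1/2) * (?y \<bullet> (?R *v ?y))))) (at 0)"
    by (auto intro!: derivative_eq_intros)
  then have "((\<lambda>s. gaussian_density m S (x + s *\<^sub>R ?e)) has_real_derivative
      - ((?R *v ?y) $ j) * gaussian_density m S x) (at 0)"
    unfolding eq by (simp add: gaussian_density_def C_def)
  then show ?thesis
    unfolding partial_deriv_def by (rule DERIV_imp_deriv)
qed

section \<open>Entropy production and flow\<close>


lemma matrix_inv_diagonal:
  fixes D :: "real^'n^'n"
  assumes "diagonal_matrix D" "\<And>i. D $ i $ i > 0"
  shows "matrix_inv D = (\<chi> i j. if i = j then 1 / D $ i $ i else 0)"
proof (rule matrix_inv_unique)
  have "(\<Sum>k\<in>UNIV. D $ i $ k * (if k = j then 1 / D $ k $ k else 0)) = (if i = j then 1 else 0)" for i j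
    using assms(1) assms(2)[of i] by (auto simp: diagonal_matrix_def if_distrib cong: if_cong)
  then show "D ** (\<chi> i j. if i = j then 1 / D $ i $ i else 0) = mat 1"
    by (simp add: matrix_matrix_mult_def mat_def vec_eq_iff)
qed

text \<open>Recentring works at any \<open>m\<close>; at the mean, the constant term is the velocity
  of the mean.\<close>

lemma drift_eq:
  "drift A B u x $ i = (A *v m + B *v u) $ i + row i A \<bullet> (x - m)"
  by (simp add: drift_def matrix_vector_mult_def row_def inner_vec_def algebra_simps sum_subtractf sum.distrib)

lemma prob_current_gaussian:
  fixes A D S :: "real^'n^'n"
  assumes S: "pos_def_matrix S" and D: "diagonal_matrix D"
  shows "prob_current A B D u (gaussian_density m S) x $ i
    = gaussian_density m S x *
      ((A *v m + B *v u) $ i + (row i A + D $ i $ i *\<^sub>R row i (matrix_inv S)) \<bullet> (x - m))"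
proof -
  let ?p = "gaussian_density m S"
  \<comment> \<open>Diagonality of \<open>D\<close> leaves only the term
    \<open>j = i\<close>.\<close>
  have "(\<Sum>j\<in>UNIV. D $ i $ j * partial_deriv j ?p x)
      = (\<Sum>j\<in>UNIV. if j = i then D $ i $ i * partial_deriv i ?p x else 0)"
    using D by (intro sum.cong) (auto simp: diagonal_matrix_def)
  also have "\<dots> = - (D $ i $ i * (row i (matrix_inv S) \<bullet> (x - m)) * ?p x)"
    by (simp add: partial_deriv_gaussian_density[OF S] matrix_vector_mul_component row_def vec_lambda_eta)
  finally show ?thesis
    by (simp add: prob_current_def drift_eq[of A B u x i m] inner_add_left algebra_simps)
qed

text \<open>By symmetry a row of the inverse is also a column. This identity collapses the
  covariance terms below to single entries of \<open>A\<close> and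
  \<open>matrix_inv S\<close>.\<close>

lemma pos_def_mult_row_inv:
  fixes S :: "real^'n^'n"
  assumes S: "pos_def_matrix S"
  shows "S *v row i (matrix_inv S) = axis i 1"
proof -
  have "row i (matrix_inv S) = row i (transpose (matrix_inv S))"
    by (simp add: pos_def_matrix_inv(2)[OF S])
  also have "\<dots> = matrix_inv S *v axis i 1"
    by (simp add: matrix_vector_mult_basis)
  finally show ?thesis
    by (simp add: matrix_vector_mul_assoc pos_def_matrix_inv(1)[OF S])
qed

text \<open>The integrand is the density times the square of one affine function, divided by
  \<open>D $ i $ i\<close>. The cross terms in its variance give \<open>2 * A $ i $ i\<close>, and
  the square of the diffusive part gives the term with the inverse covariance.\<close>

lemma production_integrand_gaussian:
  fixes A D S :: "real^'n^'n"
  assumes S: "pos_def_matrix S" and D: "diagonal_matrix D" "\<And>i. D $ i $ i > 0"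
  shows "has_bochner_integral lborel (production_integrand A B D u (gaussian_density m S) i)
    (((A *v m + B *v u) $ i)\<^sup>2 / D $ i $ i + (row i A \<bullet> (S *v row i A)) / D $ i $ i
       + matrix_inv S $ i $ i * D $ i $ i + 2 * A $ i $ i)"
proof -
  let ?v = "(A *v m + B *v u) $ i" and ?d = "D $ i $ i" and ?a = "row i A" and ?r = "row i (matrix_inv S)"
  let ?w = "?a + ?d *\<^sub>R ?r"
  have d: "?d > 0" by (rule D(2))
  have "?r \<bullet> (S *v ?a) = ?a \<bullet> (S *v ?r)"
    using S by (intro bilinear_matrix_symmetric) (simp add: pos_def_matrix_def)
  then have "?w \<bullet> (S *v ?w) = ?a \<bullet> (S *v ?a) + 2 * ?d * (?a \<bullet> (S *v ?r)) + ?d\<^sup>2 * (?r \<bullet> (S *v ?r))"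
    by (simp add: matrix_vector_right_distrib matrix_vector_mult_scaleR inner_add_left inner_add_right
        power2_eq_square algebra_simps)
  also have "\<dots> = ?a \<bullet> (S *v ?a) + 2 * ?d * A $ i $ i + ?d\<^sup>2 * matrix_inv S $ i $ i"
    unfolding pos_def_mult_row_inv[OF S] by (simp add: inner_axis row_def)
  finally have w: "(1 / ?d) * (?v * ?v + ?w \<bullet> (S *v ?w))
      = ?v\<^sup>2 / ?d + (?a \<bullet> (S *v ?a)) / ?d + matrix_inv S $ i $ i * ?d + 2 * A $ i $ i"
    using d by (simp add: field_simps power2_eq_square)
  have "production_integrand A B D u (gaussian_density m S) i
      = (\<lambda>x. (1 / ?d) * (gaussian_density m S x * ((?v + ?w \<bullet> (x - m)) * (?v + ?w \<bullet> (x - m)))))"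
  proof
    fix x
    show "production_integrand A B D u (gaussian_density m S) i x
      = (1 / ?d) * (gaussian_density m S x * ((?v + ?w \<bullet> (x - m)) * (?v + ?w \<bullet> (x - m))))"
      \<comment> \<open>Positivity of the density cancels one of the two factors in the squared
        current.\<close>
      using d gaussian_density_pos[OF S, of m x]
      unfolding production_integrand_def prob_current_gaussian[OF S D(1)]
      by (simp add: power2_eq_square)
  qed
  moreover have "has_bochner_integral lborel
      (\<lambda>x. (1 / ?d) * (gaussian_density m S x * ((?v + ?w \<bullet> (x - m)) * (?v + ?w \<bullet> (x - m)))))
      ((1 / ?d) * (?v * ?v + ?w \<bullet> (S *v ?w)))"
    by (intro has_bochner_integral_mult_right gaussian_affine_product_expectation[OF S])
  ultimately show ?thesis unfolding w by simp
qed

text \<open>Here the drift replaces one of the two affine factors and has no diffusive part, so a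
  single cross term survives and no inverse covariance appears.\<close>

lemma flow_integrand_gaussian:
  fixes A D S :: "real^'n^'n"
  assumes S: "pos_def_matrix S" and D: "diagonal_matrix D" "\<And>i. D $ i $ i > 0"
  shows "has_bochner_integral lborel (flow_integrand A B D u (gaussian_density m S) i)
    (((A *v m + B *v u) $ i)\<^sup>2 / D $ i $ i + (row i A \<bullet> (S *v row i A)) / D $ i $ i + A $ i $ i)"
proof -
  let ?v = "(A *v m + B *v u) $ i" and ?d = "D $ i $ i" and ?a = "row i A" and ?r = "row i (matrix_inv S)"
  let ?w = "?a + ?d *\<^sub>R ?r"
  have d: "?d > 0" by (rule D(2))
  have "?a \<bullet> (S *v ?w) = ?a \<bullet> (S *v ?a) + ?d * A $ i $ i"
    unfolding matrix_vector_right_distrib matrix_vector_mult_scaleR inner_add_right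
      pos_def_mult_row_inv[OF S] by (simp add: inner_axis row_def)
  then have w: "(1 / ?d) * (?v * ?v + ?a \<bullet> (S *v ?w)) = ?v\<^sup>2 / ?d + (?a \<bullet> (S *v ?a)) / ?d + A $ i $ i"
    using d by (simp add: field_simps power2_eq_square)
  have "flow_integrand A B D u (gaussian_density m S) i
      = (\<lambda>x. (1 / ?d) * (gaussian_density m S x * ((?v + ?a \<bullet> (x - m)) * (?v + ?w \<bullet> (x - m)))))"
    unfolding flow_integrand_def prob_current_gaussian[OF S D(1)] drift_eq[of A B u _ i m]
    by (simp add: fun_eq_iff)
  moreover have "has_bochner_integral lborel
      (\<lambda>x. (1 / ?d) * (gaussian_density m S x * ((?v + ?a \<bullet> (x - m)) * (?v + ?w \<bullet> (x - m)))))
      ((1 / ?d) * (?v * ?v + ?a \<bullet> (S *v ?w)))"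
    by (intro has_bochner_integral_mult_right gaussian_affine_product_expectation[OF S])
  ultimately show ?thesis unfolding w by simp
qed

section \<open>Traces and quadratic forms as coordinate sums\<close>

lemma trace_diagonal_quadratic:
  fixes A D S :: "real^'n^'n"
  assumes "diagonal_matrix D" "\<And>i. D $ i $ i > 0"
  shows "trace (transpose A ** matrix_inv D ** A ** S) = (\<Sum>i\<in>UNIV. (row i A \<bullet> (S *v row i A)) / D $ i $ i)"
proof -
  have diag: "(matrix_inv D ** M) $ i $ i = M $ i $ i / D $ i $ i" for M :: "real^'n^'n" and i
    unfolding matrix_inv_diagonal[OF assms] matrix_matrix_mult_def
    by (simp add: if_distrib[of "\<lambda>x. x * _"] cong: if_cong)
  \<comment> \<open>Cyclicity puts the diagonal matrix in front, where it only divides the diagonal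
    entries of \<open>A ** S ** transpose A\<close>.\<close>
  have "trace (transpose A ** matrix_inv D ** A ** S) = trace (matrix_inv D ** (A ** S ** transpose A))"
    using trace_mul_sym[of "transpose A" "matrix_inv D ** A ** S"] by (simp add: matrix_mul_assoc)
  also have "\<dots> = (\<Sum>i\<in>UNIV. (A ** (S ** transpose A)) $ i $ i / D $ i $ i)"
    unfolding trace_def diag by (simp only: matrix_mul_assoc)
  also have "\<dots> = (\<Sum>i\<in>UNIV. (row i A \<bullet> (S *v row i A)) / D $ i $ i)"
    by (simp add: matrix_matrix_mult_def matrix_vector_mult_def row_def inner_vec_def transpose_def)
  finally show ?thesis .
qed

lemma inner_diagonal_inv:
  fixes D :: "real^'n^'n"
  assumes "diagonal_matrix D" "\<And>i. D $ i $ i > 0"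
  shows "v \<bullet> (matrix_inv D *v v) = (\<Sum>i\<in>UNIV. (v $ i)\<^sup>2 / D $ i $ i)"
  unfolding matrix_inv_diagonal[OF assms]
  by (simp add: inner_vec_def matrix_vector_mult_def if_distrib[of "\<lambda>x. x * _"] power2_eq_square cong: if_cong)

lemma trace_mult_diagonal:
  fixes R D :: "real^'n^'n"
  assumes "diagonal_matrix D"
  shows "trace (R ** D) = (\<Sum>i\<in>UNIV. R $ i $ i * D $ i $ i)"
proof -
  have "(\<Sum>k\<in>UNIV. R $ i $ k * D $ k $ i) = (\<Sum>k\<in>UNIV. if k = i then R $ i $ i * D $ i $ i else 0)" for i
    using assms by (intro sum.cong) (auto simp: diagonal_matrix_def)
  then show ?thesis
    by (simp add: trace_def matrix_matrix_mult_def)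
qed

text \<open>A connected set that is not a singleton has no isolated points. This makes the
  derivative within \<open>T\<close> unique, also at endpoints.\<close>

lemma at_within_interval_nontrivial:
  fixes T :: "real set"
  assumes "is_interval T" "\<exists>a\<in>T. \<exists>b\<in>T. a < b" "t \<in> T"
  shows "at t within T \<noteq> bot"
proof -
  have "connected T" "\<nexists>x. T = {x}"
    using assms is_interval_connected by auto
  then have "t islimpt T"
    using assms(3) connected_imp_perfect by blast
  then show ?thesis by (simp add: trivial_limit_within)
qed

theorem mainTheorem1:
  fixes T :: "real set"
    and A :: "real ^ 'n ^ 'n" and B :: "real ^ 'm ^ 'n"
    and D :: "real \<Rightarrow> real ^ 'n ^ 'n" and u :: "real \<Rightarrow> real ^ 'm"
    and \<mu> :: "real \<Rightarrow> real ^ 'n" and \<Sigma> :: "real \<Rightarrow> real ^ 'n ^ 'n"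
    and p :: "real \<Rightarrow> real ^ 'n \<Rightarrow> real"
  assumes T: "is_interval T" "\<exists>a\<in>T. \<exists>b\<in>T. a < b"
    and u: "continuous_on T u"
    and D_diag: "\<And>t. t \<in> T \<Longrightarrow> diagonal_matrix (D t)"
    and D_pos: "\<And>t i. t \<in> T \<Longrightarrow> D t $ i $ i > 0"
    and Sigma_pos: "\<And>t. t \<in> T \<Longrightarrow> pos_def_matrix (\<Sigma> t)"
    and mu_ode: "\<And>t. t \<in> T \<Longrightarrow>
          (\<mu> has_vector_derivative (A *v \<mu> t + B *v u t)) (at t within T)"
    and Sigma_ode: "\<And>t. t \<in> T \<Longrightarrow>
          (\<Sigma> has_vector_derivative (A ** \<Sigma> t + \<Sigma> t ** transpose A + 2 *\<^sub>R D t)) (at t within T)"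
    and p: "\<And>t. t \<in> T \<Longrightarrow> p t = gaussian_density (\<mu> t) (\<Sigma> t)"
  shows "\<forall>t\<in>T.
     (\<forall>i. integrable lborel (production_integrand A B (D t) (u t) (p t) i)) \<and>
     (\<forall>i. integrable lborel (flow_integrand A B (D t) (u t) (p t) i)) \<and>
     (let \<mu>' = vector_derivative \<mu> (at t within T) in
        entropy_production A B (D t) (u t) (p t) =
          \<mu>' \<bullet> (matrix_inv (D t) *v \<mu>') + trace (transpose A ** matrix_inv (D t) ** A ** \<Sigma> t)
          + trace (matrix_inv (\<Sigma> t) ** D t) + 2 * trace A \<and>
        entropy_flow A B (D t) (u t) (p t) =
          \<mu>' \<bullet> (matrix_inv (D t) *v \<mu>') + trace (transpose A ** matrix_inv (D t) ** A ** \<Sigma> t)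
          + trace A)"
proof
  fix t assume t: "t \<in> T"
  note S = Sigma_pos[OF t] and D = D_diag[OF t] D_pos[OF t]
  \<comment> \<open>Uniqueness of the derivative identifies \<open>vector_derivative\<close> with
    the right-hand side of the mean equation, which is the constant term of the current.\<close>
  have \<mu>': "vector_derivative \<mu> (at t within T) = A *v \<mu> t + B *v u t"
    by (rule vector_derivative_within[OF at_within_interval_nontrivial[OF T t] mu_ode[OF t]])
  note prod = production_integrand_gaussian[OF S D, where m = "\<mu> t" and u = "u t" and A = A and B = B]
  note flow = flow_integrand_gaussian[OF S D, where m = "\<mu> t" and u = "u t" and A = A and B = B]
  note traces = inner_diagonal_inv[OF D] trace_diagonal_quadratic[OF D] trace_mult_diagonal[OF D(1)]
  show "(\<forall>i. integrable lborel (production_integrand A B (D t) (u t) (p t) i)) \<and>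
     (\<forall>i. integrable lborel (flow_integrand A B (D t) (u t) (p t) i)) \<and>
     (let \<mu>' = vector_derivative \<mu> (at t within T) in
        entropy_production A B (D t) (u t) (p t) =
          \<mu>' \<bullet> (matrix_inv (D t) *v \<mu>') + trace (transpose A ** matrix_inv (D t) ** A ** \<Sigma> t)
          + trace (matrix_inv (\<Sigma> t) ** D t) + 2 * trace A \<and>
        entropy_flow A B (D t) (u t) (p t) =
          \<mu>' \<bullet> (matrix_inv (D t) *v \<mu>') + trace (transpose A ** matrix_inv (D t) ** A ** \<Sigma> t)
          + trace A)"
    \<comment> \<open>Once the integrals and traces are sums over coordinates, the two sides agree
      term by term.\<close>
    unfolding Let_def \<mu>' p[OF t] traces entropy_production_def entropy_flow_def
      has_bochner_integral_integral_eq[OF prod] has_bochner_integral_integral_eq[OF flow]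
    using prod flow
    by (auto simp: has_bochner_integral_iff sum.distrib trace_def sum_distrib_left)
qed

end
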